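(* Let $\mathfrak{g}$ be of type $B_n$. For $i,j\in I=\{1,2,\dots,n\}$, $$(1+z^{4n-2})\,\widetilde C_{ij}(z)=\begin{cases}\sum_{s=1}^{\min(i,j)}\bigl(z^{2(|i-j|+2s-1)}+z^{2(2n-i-j-2+2s)}\bigr)&\text{if }1\le i,j<n,\\ \sum_{s=1}^{i}z^{2n-2i-3+4s}&\text{if }i<n,\ j=n,\\ \sum_{s=1}^{j}\bigl(z^{2n-2j-4+4s}+z^{2n-2j-2+4s}\bigr)&\text{if }i=n,\ j<n,\\ \sum_{s=1}^{n}z^{4s-3}&\text{if }i=j=n.\end{cases}$$
   Context: Type $B_n$ ($n\ge2$): label the Dynkin nodes $I=\{1,\dots,n\}$ along the chain, with $n$ the node of the short simple root. Put $(d_1,\dots,d_n)=(2,\dots,2,1)$. The Cartan matrix $(c_{ij})$ has $c_{ii}=2$, $c_{ij}=0$ if $|i-j|>1$, $c_{n,n-1}=-2$, and all other $c_{ij}$ with $|i-j|=1$ equal to $-1$ (in particular $c_{n-1,n}=-1$). The quantum Cartan matrix is $C(z)=(C_{ij}(z))_{i,j\in I}$ with $C_{ii}(z)=z^{d_i}+z^{-d_i}$ and $C_{ij}(z)=[c_{ij}]_z$ for $i\ne j$, where $[k]_z=(z^k-z^{-k})/(z-z^{-1})$ (so $[-1]_z=-1$, $[-2]_z=-(z+z^{-1})$). It is invertible over $\mathbb{Q}(z)$, and $\widetilde C(z)=(\widetilde C_{ij}(z))_{i,j\in I}=C(z)^{-1}$. *)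

theory Defs
  imports
    "HOL-Computational_Algebra.Fraction_Field"
    "HOL-Computational_Algebra.Polynomial"
    Jordan_Normal_Form.Gauss_Jordan_Elimination
begin

type_synonym ratfun = "rat poly fract"

definition zvar :: ratfun where
  "zvar = Fraction_Field.Fract [:0, 1:] 1"

definition qint :: "int \<Rightarrow> ratfun" where
  "qint k = (zvar powi k - zvar powi (- k)) / (zvar - zvar powi (-1))"

text \<open>Dynkin nodes are the natural numbers from 1 to n, with n the node of the short simple root;
  the functions \<open>sym_B\<close>, \<open>cartan_B\<close> and \<open>qcartan_entry_B\<close> are meaningful only for such indices (and n at least 2).\<close>

definition sym_B :: "nat \<Rightarrow> nat \<Rightarrow> int" where
  "sym_B n i = (if i = n then 1 else 2)"

definition cartan_B :: "nat \<Rightarrow> nat \<Rightarrow> nat \<Rightarrow> int" where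
  "cartan_B n i j =
     (if i = j then 2
      else if \<bar>int i - int j\<bar> > 1 then 0
      else if i = n \<and> j = n - 1 then -2
      else -1)"

definition qcartan_entry_B :: "nat \<Rightarrow> nat \<Rightarrow> nat \<Rightarrow> ratfun" where
  "qcartan_entry_B n i j =
     (if i = j then zvar powi (sym_B n i) + zvar powi (- sym_B n i)
      else qint (cartan_B n i j))"

text \<open>Matrix rows and columns are counted from 0, so node i sits at position i - 1.\<close>

definition qcartan_B :: "nat \<Rightarrow> ratfun mat" where
  "qcartan_B n = mat n n (\<lambda>(i, j). qcartan_entry_B n (i + 1) (j + 1))"

definition qcartan_inv_B :: "nat \<Rightarrow> ratfun mat" where
  "qcartan_inv_B n = the (mat_inverse (qcartan_B n))"

definition qcartan_inv_entry_B :: "nat \<Rightarrow> nat \<Rightarrow> nat \<Rightarrow> ratfun" where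
  "qcartan_inv_entry_B n i j = qcartan_inv_B n $$ (i - 1, j - 1)"

end

theory Submission
  imports Defs Jordan_Normal_Form.Determinant
begin

text \<open>Put \<open>s(a) = z\<^sup>a - z\<^sup>-\<^sup>a\<close> and \<open>c(a) = z\<^sup>a + z\<^sup>-\<^sup>a\<close>. Summing the geometric series turns all four cases
  into the single Green-function formula
  \<open>z\<^sup>2\<^sup>n\<^sup>-\<^sup>1 s(2 min(i,j)) c(2n-1-2 max(i,j)) w\<^sub>j / s(2)\<close>, with \<open>w\<^sub>j = 1\<close> for \<open>j < n\<close> and \<open>w\<^sub>n = 1/c(1)\<close>.
  As functions of \<open>k\<close>, \<open>s(2k)\<close> and \<open>c(2n-1-2k)\<close> both solve \<open>c(2) x\<^sub>k = x\<^sub>k\<^sub>-\<^sub>1 + x\<^sub>k\<^sub>+\<^sub>1\<close>,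
  the first satisfying the boundary condition at 0 and the second the one at \<open>n\<close>;
  their Wronskian is the constant \<open>s(2) c(2n-1)\<close>.\<close>

section \<open>Sums and differences of opposite powers\<close>

definition powi_diff :: "'a::field \<Rightarrow> int \<Rightarrow> 'a" where
  "powi_diff z a = z powi a - z powi (- a)"

definition powi_sum :: "'a::field \<Rightarrow> int \<Rightarrow> 'a" where
  "powi_sum z a = z powi a + z powi (- a)"

lemma powi_diff_0 [simp]: "powi_diff z 0 = 0"
  by (simp add: powi_diff_def)

lemma powi_diff_minus: "powi_diff z (- a) = - powi_diff z a"
  by (simp add: powi_diff_def)

lemma powi_sum_minus: "powi_sum z (- a) = powi_sum z a"
  by (simp add: powi_sum_def add.commute)

lemma powi_diff_mult_powi_sum:
  assumes "z \<noteq> 0"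
  shows "powi_diff z a * powi_sum z b = powi_diff z (a + b) + powi_diff z (a - b)"
  using assms
  by (simp add: powi_diff_def powi_sum_def power_int_add power_int_diff power_int_minus field_simps)

lemma powi_sum_mult_powi_sum:
  assumes "z \<noteq> 0"
  shows "powi_sum z a * powi_sum z b = powi_sum z (a + b) + powi_sum z (a - b)"
  using assms
  by (simp add: powi_sum_def power_int_add power_int_diff power_int_minus field_simps)

text \<open>After both products are expanded, the terms in \<open>a - b\<close> cancel, and oddness
  of \<open>powi_diff\<close> regroups the rest. Only \<open>a + b\<close> survives, so the value
  stays fixed along the chain, where \<open>a = 2k\<close> and
  \<open>b = 2n - 1 - 2k\<close>.\<close>

lemma powi_diff_wronskian:
  assumes "z \<noteq> 0"
  shows "powi_diff z (a + 2) * powi_sum z b - powi_diff z a * powi_sum z (b - 2)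
    = powi_diff z 2 * powi_sum z (a + b)"
proof -
  have "powi_diff z (2 - (a + b)) = - powi_diff z (a + b - 2)"
    using powi_diff_minus[of z "a + b - 2"] by (simp add: algebra_simps)
  then show ?thesis
    unfolding powi_diff_mult_powi_sum[OF assms] by (simp add: algebra_simps)
qed

text \<open>The sum telescopes: \<open>powi_diff z 2\<close> times the term at \<open>s\<close> is
  \<open>z powi (b + 4s + 2) - z powi (b + 4s - 2)\<close>.\<close>

lemma sum_powi_geometric:
  assumes "z \<noteq> 0"
  shows "powi_diff z 2 * (\<Sum>s = 1..m. z powi (b + 4 * int s)) =
    z powi (b + 2 + 2 * int m) * powi_diff z (2 * int m)"
proof (induction m)
  case 0
  then show ?case by simp
next
  case (Suc m)
  have "z powi (b + 2 + 2 * int m) * powi_diff z (2 * int m)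
      + powi_diff z 2 * z powi (b + 4 * int (Suc m))
    = z powi (b + 2 + 2 * int (Suc m)) * powi_diff z (2 * int (Suc m))"
    unfolding powi_diff_def right_diff_distrib left_diff_distrib
      power_int_add[symmetric, OF disjI1[OF assms]]
    by (simp add: algebra_simps)
  with Suc show ?case by (simp add: distrib_left)
qed

section \<open>The Green function on the chain\<close>

text \<open>Row \<open>n\<close> of the quantum Cartan matrix has the common factor
  \<open>powi_sum z 1\<close>, hence the division in column \<open>n\<close>. The value at
  \<open>i = 0\<close> is that of a ghost node, which spares node 1 a recurrence of its own.\<close>

definition green_B :: "'a::field \<Rightarrow> nat \<Rightarrow> nat \<Rightarrow> nat \<Rightarrow> 'a" where
  "green_B z n i j = powi_diff z (2 * int (min i j)) * powi_sum z (2 * int n - 1 - 2 * int (max i j))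
     / (if j = n then powi_sum z 1 else 1)"

lemma green_B_0 [simp]: "green_B z n 0 j = 0"
  by (simp add: green_B_def)

text \<open>Away from \<open>i = j\<close> just one factor varies with \<open>i\<close>, and it
  solves the homogeneous recurrence; at \<open>i = j\<close> the two branches meet with a defect
  equal to the Wronskian.\<close>

lemma green_B_recurrence:
  assumes "z \<noteq> 0" and "0 < i" and "i < n"
  shows "powi_sum z 2 * green_B z n i j - green_B z n (i - 1) j - green_B z n (i + 1) j
    = (if i = j then powi_diff z 2 * powi_sum z (2 * int n - 1) else 0)"
proof -
  let ?w = "if j = n then powi_sum z 1 else 1"
  have s: "powi_sum z 2 * powi_diff z (2 * int i)
      = powi_diff z (2 * int i + 2) + powi_diff z (2 * int i - 2)"
    using powi_diff_mult_powi_sum[OF assms(1), of "2 * int i" 2] by (simp add: mult.commute)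
  have c: "powi_sum z 2 * powi_sum z b = powi_sum z (b + 2) + powi_sum z (b - 2)" for b
    using powi_sum_mult_powi_sum[OF assms(1), of b 2] by (simp add: mult.commute)
  consider "i < j" | "i = j" | "j < i" by linarith
  then show ?thesis
  proof cases
    case 1
    have eq: "2 * int (i - 1) = 2 * int i - 2" "2 * int (i + 1) = 2 * int i + 2"
      using assms by auto
    have "powi_sum z 2 * green_B z n i j - green_B z n (i - 1) j - green_B z n (i + 1) j
      = (powi_sum z 2 * powi_diff z (2 * int i) - powi_diff z (2 * int i - 2)
          - powi_diff z (2 * int i + 2)) * powi_sum z (2 * int n - 1 - 2 * int j) / ?w"
      using 1 unfolding green_B_def eq[symmetric] left_diff_distrib diff_divide_distrib
      by (simp add: min_absorb1 max_absorb2)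
    with 1 s show ?thesis by simp
  next
    case 2
    \<comment> \<open>Here \<open>j = i < n\<close>, so the weight is 1, and only the neighbour
      \<open>i + 1\<close> lies on the second branch.\<close>
    have "powi_sum z 2 * green_B z n i j - green_B z n (i - 1) j - green_B z n (i + 1) j
      = (powi_sum z 2 * powi_diff z (2 * int i) - powi_diff z (2 * int i - 2))
          * powi_sum z (2 * int n - 1 - 2 * int i)
        - powi_diff z (2 * int i) * powi_sum z (2 * int n - 1 - 2 * int i - 2)"
      using 2 assms unfolding green_B_def by (simp add: of_nat_diff algebra_simps)
    also have "\<dots> = powi_diff z 2 * powi_sum z (2 * int n - 1)"
      using powi_diff_wronskian[OF assms(1), of "2 * int i" "2 * int n - 1 - 2 * int i"] s
      by (simp add: algebra_simps)
    finally show ?thesis using 2 by simp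
  next
    case 3
    then have "powi_sum z 2 * green_B z n i j - green_B z n (i - 1) j - green_B z n (i + 1) j
      = powi_diff z (2 * int j) * (powi_sum z 2 * powi_sum z (2 * int n - 1 - 2 * int i)
          - powi_sum z (2 * int n - 1 - 2 * int i + 2) - powi_sum z (2 * int n - 1 - 2 * int i - 2))"
      using assms unfolding green_B_def by (simp add: of_nat_diff algebra_simps)
    with 3 c show ?thesis by simp
  qed
qed

text \<open>Since \<open>powi_sum\<close> is even, the second solution takes equal values at
  \<open>n - 1\<close> and \<open>n\<close>, which settles \<open>j < n\<close>. For
  \<open>j = n\<close> the weight cancels these values, and the Wronskian with \<open>b = 1\<close>
  remains.\<close>

lemma green_B_last:
  assumes "z \<noteq> 0" and "powi_sum z 1 \<noteq> 0" and "0 < n" and "j \<le> n"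
  shows "powi_sum z 1 * (green_B z n n j - green_B z n (n - 1) j)
    = (if j = n then powi_diff z 2 * powi_sum z (2 * int n - 1) else 0)"
proof (cases "j = n")
  case True
  have "2 * int (n - 1) = 2 * int n - 2" using assms by auto
  then have "powi_sum z 1 * (green_B z n n j - green_B z n (n - 1) j)
    = powi_sum z 1 * (powi_diff z (2 * int n) - powi_diff z (2 * int n - 2))"
    using True assms powi_sum_minus[of z 1] by (simp add: green_B_def)
  also have "\<dots> = powi_diff z 2 * powi_sum z (2 * int n - 1)"
    using powi_diff_wronskian[OF assms(1), of "2 * int n - 2" 1] powi_sum_minus[of z 1]
    by (simp add: algebra_simps)
  finally show ?thesis using True by simp
next
  case False
  then show ?thesis
    using assms powi_sum_minus[of z 1] by (simp add: green_B_def of_nat_diff)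
qed

section \<open>Nonvanishing in the field of rational functions\<close>

lemma zvar_power: "zvar ^ k = Fraction_Field.Fract (monom 1 k) 1"
  by (induction k) (simp_all add: zvar_def One_fract_def monom_Suc)

text \<open>A monomial of positive degree is not a constant. Applied to even powers, this keeps the
  later denominators nonzero.\<close>

lemma zvar_power_neq:
  assumes "0 < k"
  shows "zvar ^ k \<noteq> 1" and "zvar ^ k \<noteq> - 1"
proof -
  have "monom (1::rat) k \<noteq> [:c:]" for c
    using degree_monom_eq[of "1::rat" k] assms by (metis degree_pCons_0 neq0_conv zero_neq_one)
  from this[of 1] this[of "-1"] show "zvar ^ k \<noteq> 1" "zvar ^ k \<noteq> - 1"
    unfolding zvar_power One_fract_def by (simp_all add: eq_fract one_pCons)
qed

lemma zvar_neq_0: "zvar \<noteq> 0"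
  by (simp add: zvar_def Zero_fract_def eq_fract)

lemma powi_diff_zvar_neq_0:
  assumes "0 < a"
  shows "powi_diff zvar a \<noteq> 0"
proof
  assume "powi_diff zvar a = 0"
  then have "zvar powi a * zvar powi a = 1"
    using zvar_neq_0 by (simp add: powi_diff_def power_int_minus field_simps)
  then have "zvar powi (a + a) = 1"
    using zvar_neq_0 by (subst power_int_add) auto
  then have "zvar ^ nat (a + a) = 1" using assms by (simp add: power_int_def)
  then show False using zvar_power_neq assms by simp
qed

lemma powi_sum_zvar_neq_0:
  assumes "0 < a"
  shows "powi_sum zvar a \<noteq> 0"
proof
  assume "powi_sum zvar a = 0"
  then have "zvar powi a * zvar powi a = - 1"
    using zvar_neq_0 by (simp add: powi_sum_def power_int_minus field_simps add_eq_0_iff)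
  then have "zvar powi (a + a) = - 1"
    using zvar_neq_0 by (subst power_int_add) auto
  then have "zvar ^ nat (a + a) = - 1" using assms by (simp add: power_int_def)
  then show False using zvar_power_neq assms by simp
qed

section \<open>Inverting the quantum Cartan matrix\<close>

lemma qint_simps:
  "qint 0 = 0" "qint (- 1) = - 1" "qint (- 2) = - powi_sum zvar 1"
proof -
  have q: "qint k = powi_diff zvar k / powi_diff zvar 1" for k
    by (simp add: qint_def powi_diff_def)
  have "powi_diff zvar 2 = powi_diff zvar 1 * powi_sum zvar 1"
    using powi_diff_mult_powi_sum[OF zvar_neq_0, of 1 1] by simp
  then show "qint 0 = 0" "qint (- 1) = - 1" "qint (- 2) = - powi_sum zvar 1"
    using powi_diff_zvar_neq_0[of 1] by (simp_all add: q powi_diff_minus)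
qed

lemma qcartan_entry_B_eq:
  assumes "2 \<le> n" and "i \<le> n" and "j \<le> n"
  shows "qcartan_entry_B n i j =
     (if i = j then powi_sum zvar (if i = n then 1 else 2)
      else if i = n \<and> j = n - 1 then - powi_sum zvar 1
      else if j = i + 1 \<or> i = j + 1 then - 1 else 0)"
  using assms
  by (auto simp: qcartan_entry_B_def sym_B_def cartan_B_def qint_simps powi_sum_def)

lemma qcartan_B_mult_green_B:
  assumes n: "2 \<le> n" and i: "i \<in> {1..n}" and j: "j \<in> {1..n}"
  shows "(\<Sum>k = 1..n. qcartan_entry_B n i k * green_B zvar n k j)
    = (if i = j then powi_diff zvar 2 * powi_sum zvar (2 * int n - 1) else 0)"
proof -
  let ?f = "\<lambda>k. qcartan_entry_B n i k * green_B zvar n k j"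
  \<comment> \<open>The matrix entry at \<open>k = 0\<close> need not vanish, but
    \<open>green_B\<close> does; with this ghost term row 1 has two neighbours like the other rows
    below \<open>n\<close>.\<close>
  have "sum ?f {1..n} = sum ?f {0..n}"
    by (rule sum.mono_neutral_left) (auto simp: not_less_eq_eq)
  also have "\<dots> = (if i = j then powi_diff zvar 2 * powi_sum zvar (2 * int n - 1) else 0)"
  proof (cases "i = n")
    case True
    have "sum ?f {0..n} = sum ?f {n - 1, n}"
      using n by (intro sum.mono_neutral_right) (auto simp: True qcartan_entry_B_eq)
    also have "\<dots> = powi_sum zvar 1 * (green_B zvar n n j - green_B zvar n (n - 1) j)"
      using n True by (simp add: qcartan_entry_B_eq algebra_simps)
    finally show ?thesis
      using green_B_last[OF zvar_neq_0 powi_sum_zvar_neq_0, of n j] n j True by auto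
  next
    case False
    have "sum ?f {0..n} = sum ?f {i - 1, i, i + 1}"
      using n i False by (intro sum.mono_neutral_right) (auto simp: qcartan_entry_B_eq)
    also have "\<dots> = ?f (i - 1) + ?f i + ?f (i + 1)"
    proof -
      have "i - 1 \<noteq> i" "i - 1 \<noteq> i + 1" using i by auto
      then show ?thesis by simp
    qed
    also have "\<dots> = powi_sum zvar 2 * green_B zvar n i j - green_B zvar n (i - 1) j
        - green_B zvar n (i + 1) j"
      using n i False by (auto simp: qcartan_entry_B_eq)
    finally show ?thesis
      using green_B_recurrence[OF zvar_neq_0, of i n j] i False by simp
  qed
  finally show ?thesis .
qed

lemma qcartan_inv_entry_B_eq:
  assumes n: "2 \<le> n" and "i \<in> {1..n}" and "j \<in> {1..n}"
  shows "qcartan_inv_entry_B n i j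
    = green_B zvar n i j / (powi_diff zvar 2 * powi_sum zvar (2 * int n - 1))"
proof -
  let ?d = "powi_diff zvar 2 * powi_sum zvar (2 * int n - 1)"
  let ?G = "mat n n (\<lambda>(i, j). green_B zvar n (i + 1) (j + 1) / ?d)"
  have d: "?d \<noteq> 0"
    using powi_diff_zvar_neq_0[of 2] powi_sum_zvar_neq_0[of "2 * int n - 1"] n by simp
  have C: "qcartan_B n \<in> carrier_mat n n" and G: "?G \<in> carrier_mat n n"
    by (simp_all add: qcartan_B_def)
  have CG: "qcartan_B n * ?G = 1\<^sub>m n"
  proof (rule eq_matI)
    fix i j assume ij: "i < dim_row (1\<^sub>m n :: ratfun mat)" "j < dim_col (1\<^sub>m n :: ratfun mat)"
    then have "(qcartan_B n * ?G) $$ (i, j)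
      = (\<Sum>k = 0..<n. qcartan_entry_B n (i + 1) (k + 1) * green_B zvar n (k + 1) (j + 1) / ?d)"
      by (simp add: qcartan_B_def scalar_prod_def)
    also have "\<dots> = (\<Sum>k = 1..n. qcartan_entry_B n (i + 1) k * green_B zvar n k (j + 1)) / ?d"
      unfolding sum_divide_distrib
      by (rule sum.reindex_bij_witness[of _ "\<lambda>k. k - 1" Suc]) auto
    also have "\<dots> = 1\<^sub>m n $$ (i, j)"
      using qcartan_B_mult_green_B[OF n, of "i + 1" "j + 1"] ij d by simp
    finally show "(qcartan_B n * ?G) $$ (i, j) = 1\<^sub>m n $$ (i, j)" .
  qed (simp_all add: qcartan_B_def)
  \<comment> \<open>A right inverse of a square matrix over a field is two-sided. Hence
    \<open>qcartan_B n\<close> is a unit and \<open>mat_inverse\<close> does return a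
    matrix.\<close>
  have GC: "?G * qcartan_B n = 1\<^sub>m n"
    by (rule mat_mult_left_right_inverse[OF C G CG])
  have "qcartan_B n \<in> Units (ring_mat TYPE(ratfun) n ())"
    using C G CG GC by (auto simp: Units_def ring_mat_def)
  then obtain B where B: "mat_inverse (qcartan_B n) = Some B"
    using mat_inverse(1)[OF C, where b = "()"] by (cases "mat_inverse (qcartan_B n)") auto
  then have "B * qcartan_B n = 1\<^sub>m n" "B \<in> carrier_mat n n"
    using mat_inverse(2)[OF C] by blast+
  \<comment> \<open>Writing \<open>C\<close> for \<open>qcartan_B n\<close>:
    \<open>B = B (C G) = (B C) G = G\<close>.\<close>
  then have "B = ?G"
    using assoc_mult_mat[OF _ C G, of B n] left_mult_one_mat[OF G] right_mult_one_mat[of B n n] CG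
    by simp
  moreover have "i - 1 < n" "j - 1 < n" "i - 1 + 1 = i" "j - 1 + 1 = j"
    using assms by auto
  ultimately show ?thesis
    using B by (simp add: qcartan_inv_entry_B_def qcartan_inv_B_def del: One_nat_def)
qed

section \<open>Comparison with the four explicit sums\<close>

theorem theorem3p12:
  fixes n i j :: nat
  assumes "n \<ge> 2" and "i \<in> {1..n}" and "j \<in> {1..n}"
  shows "(1 + zvar powi (4 * int n - 2)) * qcartan_inv_entry_B n i j =
    (if i < n \<and> j < n then
       (\<Sum>s = 1..min i j.
          zvar powi (2 * (\<bar>int i - int j\<bar> + 2 * int s - 1)) +
          zvar powi (2 * (2 * int n - int i - int j - 2 + 2 * int s)))
     else if i < n \<and> j = n then
       (\<Sum>s = 1..i. zvar powi (2 * int n - 2 * int i - 3 + 4 * int s))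
     else if i = n \<and> j < n then
       (\<Sum>s = 1..j.
          zvar powi (2 * int n - 2 * int j - 4 + 4 * int s) +
          zvar powi (2 * int n - 2 * int j - 2 + 4 * int s))
     else
       (\<Sum>s = 1..n. zvar powi (4 * int s - 3)))" (is "_ = ?rhs")
proof -
  let ?z = "zvar powi (2 * int n - 1)"
  let ?sd = "powi_diff zvar 2"
  have nz: "?sd \<noteq> 0" "powi_sum zvar 1 \<noteq> 0" "powi_sum zvar (2 * int n - 1) \<noteq> 0"
    using powi_diff_zvar_neq_0[of 2] powi_sum_zvar_neq_0[of 1]
      powi_sum_zvar_neq_0[of "2 * int n - 1"] assms(1) by simp_all
  note add = power_int_add[symmetric, OF disjI1[OF zvar_neq_0]]
  note geo = sum_powi_geometric[OF zvar_neq_0]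
  \<comment> \<open>This cancels one factor of the normalisation; multiplying by \<open>?sd\<close>
    clears the other, leaving one geometric-sum identity per case.\<close>
  have "1 + zvar powi (4 * int n - 2) = ?z * powi_sum zvar (2 * int n - 1)"
    unfolding powi_sum_def distrib_left add by (simp add: algebra_simps)
  then have lhs: "?sd * ((1 + zvar powi (4 * int n - 2)) * qcartan_inv_entry_B n i j)
      = ?z * green_B zvar n i j"
    using nz by (simp add: qcartan_inv_entry_B_eq[OF assms])
  consider "i < n" "j < n" | "i < n" "j = n" | "i = n" "j < n" | "i = n" "j = n"
    using assms by fastforce
  then have "?sd * ?rhs = ?z * green_B zvar n i j"
  proof cases
    case 1
    define m M where "m = min i j" and "M = max i j"
    have e: "2 * (\<bar>int i - int j\<bar> + 2 * s - 1) = 2 * int M - 2 * int m - 2 + 4 * s"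
      "2 * (2 * int n - int i - int j - 2 + 2 * s) = 4 * int n - 2 * int M - 2 * int m - 4 + 4 * s"
      for s by (simp_all add: m_def M_def min_def max_def)
    have "?rhs = (\<Sum>s = 1..m. zvar powi (2 * int M - 2 * int m - 2 + 4 * int s))
        + (\<Sum>s = 1..m. zvar powi (4 * int n - 2 * int M - 2 * int m - 4 + 4 * int s))"
      unfolding e m_def[symmetric] using 1 by (simp add: sum.distrib)
    \<comment> \<open>The shift by \<open>2 + 2 * int m\<close> in the geometric sum removes
      \<open>m\<close> from both prefactor exponents.\<close>
    then have "?sd * ?rhs
        = (zvar powi (2 * int M) + zvar powi (4 * int n - 2 * int M - 2)) * powi_diff zvar (2 * int m)"
      by (simp only: distrib_left geo) (simp add: algebra_simps)
    also have "zvar powi (2 * int M) + zvar powi (4 * int n - 2 * int M - 2)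
        = ?z * powi_sum zvar (2 * int n - 1 - 2 * int M)"
      unfolding powi_sum_def distrib_left add by (simp add: algebra_simps)
    finally show ?thesis
      using 1 by (simp add: green_B_def m_def M_def)
  next
    case 2
    have "?sd * ?rhs = ?sd * (\<Sum>s = 1..i. zvar powi (2 * int n - 2 * int i - 3 + 4 * int s))"
      using 2 by simp
    also have "\<dots> = ?z * powi_diff zvar (2 * int i)"
      unfolding geo by simp
    \<comment> \<open>With \<open>max i j = n\<close> the second factor is
      \<open>powi_sum zvar (-1)\<close>, which cancels against the weight.\<close>
    finally show ?thesis
      using 2 nz powi_sum_minus[of zvar 1] by (simp add: green_B_def)
  next
    case 3
    have "?sd * ?rhs = ?sd * (\<Sum>s = 1..j. zvar powi (2 * int n - 2 * int j - 4 + 4 * int s))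
        + ?sd * (\<Sum>s = 1..j. zvar powi (2 * int n - 2 * int j - 2 + 4 * int s))"
      using 3 by (simp add: sum.distrib distrib_left)
    also have "\<dots> = (zvar powi (2 * int n - 2) + zvar powi (2 * int n)) * powi_diff zvar (2 * int j)"
      unfolding geo by (simp add: algebra_simps)
    \<comment> \<open>Now \<open>j < n\<close> has weight 1, so \<open>powi_sum zvar 1\<close>
      survives and accounts for the two powers in each summand.\<close>
    also have "zvar powi (2 * int n - 2) + zvar powi (2 * int n) = ?z * powi_sum zvar 1"
      unfolding powi_sum_def distrib_left add by (simp add: algebra_simps)
    finally show ?thesis
      using 3 powi_sum_minus[of zvar 1] by (simp add: green_B_def)
  next
    case 4
    have "?sd * ?rhs = ?sd * (\<Sum>s = 1..n. zvar powi (- 3 + 4 * int s))"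
      using 4 by (simp add: algebra_simps)
    also have "\<dots> = ?z * powi_diff zvar (2 * int n)"
      unfolding geo by (simp add: algebra_simps)
    finally show ?thesis
      using 4 nz powi_sum_minus[of zvar 1] by (simp add: green_B_def)
  qed
  with lhs have "?sd * ((1 + zvar powi (4 * int n - 2)) * qcartan_inv_entry_B n i j) = ?sd * ?rhs"
    by (rule trans[OF _ sym])
  then show ?thesis
    using nz(1) by (rule mult_left_cancel[THEN iffD1, rotated])
qed

end
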